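(* For every prime power $q$: if $d=3$ and $n=6$, then $\#C_{q,6,3}(\mathbb{F}_{q^6}) = 1+q^{n-1+d}=1+q^{8}$; and if $d=4$ and $n=8$, then $\#C_{q,8,4}(\mathbb{F}_{q^8}) = 1+q^{n-1+d}=1+q^{11}$.
   Context: Let $q=p^r$ be a prime power, let $n\ge 4$ be an integer and let $d$ be a divisor of $n$ with $1<d<n$. Put $R_d(x)=x+x^q+x^{q^2}+\cdots+x^{q^{d-2}}+x^{q^{d-1}+q^d-1}$. The curve $C=C_{q,n,d}$ is the projective plane curve over $\mathbb{F}_q$ defined by the homogenization of the affine equation $y+y^q+y^{q^2}+\cdots+y^{q^{n-1}}=R_d(x)$. $C(\mathbb{F}_{q^n})$ denotes the set of $\mathbb{F}_{q^n}$-rational points of this projective plane curve (including points at infinity). *)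

theory Defs
  imports Complex_Main "HOL-Library.Cardinality" "HOL-Computational_Algebra.Computational_Algebra"
begin

definition field_embedding :: "('k::field \<Rightarrow> 'l::field) \<Rightarrow> bool" where
  "field_embedding \<iota> \<longleftrightarrow>
     \<iota> 1 = 1 \<and> (\<forall>a b. \<iota> (a + b) = \<iota> a + \<iota> b) \<and> (\<forall>a b. \<iota> (a * b) = \<iota> a * \<iota> b)"

definition proj_rel :: "(('l::field \<times> 'l \<times> 'l) \<times> ('l \<times> 'l \<times> 'l)) set" where
  "proj_rel = {((X, Y, Z), (X', Y', Z')).
     (X, Y, Z) \<noteq> (0, 0, 0) \<and>
     (\<exists>c. c \<noteq> 0 \<and> X' = c * X \<and> Y' = c * Y \<and> Z' = c * Z)}"

definition proj_plane :: "('l::field \<times> 'l \<times> 'l) set set" where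
  "proj_plane = {v. v \<noteq> (0, 0, 0)} // proj_rel"

text \<open>
  A bivariate polynomial \<open>f\<close> in \<open>x, y\<close> is represented as a polynomial in \<open>y\<close> whose coefficients
  are polynomials in \<open>x\<close>: the coefficient of \<open>x ^ i * y ^ j\<close> is \<open>coeff (coeff f j) i\<close>.
  The total degree is only meaningful for \<open>f \<noteq> 0\<close>.
\<close>

definition total_degree :: "'k::field poly poly \<Rightarrow> nat" where
  "total_degree f = Max {i + j | i j. coeff (coeff f j) i \<noteq> 0}"

text \<open>
  Value at \<open>(X, Y, Z)\<close> of the homogenization \<open>Z ^ total_degree f * f (X / Z, Y / Z)\<close> of \<open>f\<close>,
  with the coefficients carried along \<open>\<iota>\<close> into the field containing \<open>X, Y, Z\<close>.
\<close>

definition homogenization_eval ::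
    "('k::field \<Rightarrow> 'l::field) \<Rightarrow> 'k poly poly \<Rightarrow> 'l \<Rightarrow> 'l \<Rightarrow> 'l \<Rightarrow> 'l" where
  "homogenization_eval \<iota> f X Y Z =
     (\<Sum>j\<le>degree f. \<Sum>i\<le>degree (coeff f j).
        \<iota> (coeff (coeff f j) i) * X ^ i * Y ^ j * Z ^ (total_degree f - i - j))"

definition proj_curve_points :: "('k::field \<Rightarrow> 'l::field) \<Rightarrow> 'k poly poly \<Rightarrow> ('l \<times> 'l \<times> 'l) set set" where
  "proj_curve_points \<iota> f =
     {P \<in> proj_plane. \<forall>(X, Y, Z) \<in> P. homogenization_eval \<iota> f X Y Z = 0}"

text \<open>The truncated subtractions below are exact for \<open>d \<ge> 1\<close> and \<open>q \<ge> 1\<close>.\<close>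

definition R_poly :: "nat \<Rightarrow> nat \<Rightarrow> 'k::field poly" where
  "R_poly q d = (\<Sum>i<d - 1. monom 1 (q ^ i)) + monom 1 (q ^ (d - 1) + q ^ d - 1)"

definition C_poly :: "nat \<Rightarrow> nat \<Rightarrow> nat \<Rightarrow> 'k::field poly poly" where
  "C_poly q n d = (\<Sum>i<n. monom 1 (q ^ i)) - [:R_poly q d:]"

end

theory Submission
  imports Defs
begin

text \<open>
  Write \<open>L\<close> for the field with \<open>q ^ n\<close> elements, where \<open>n = 2 * d\<close>. The left-hand side of the affine
  equation is the trace of \<open>y\<close> from \<open>L\<close> to its subfield \<open>{z. z ^ q = z}\<close>. The trace takes every value in
  that subfield exactly \<open>q ^ (n - 1)\<close> times (\<open>card_trace_fibre\<close>), so the number of affine points is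
  \<open>q ^ (n - 1)\<close> times the number of \<open>x\<close> with \<open>R x ^ q = R x\<close>. The claim is that these are exactly the
  \<open>q ^ d\<close> elements with \<open>x ^ (q ^ d) = x\<close>.

  If \<open>x ^ (q ^ d) = x\<close>, the last term of \<open>R x\<close> collapses to \<open>x ^ (q ^ (d - 1))\<close> and \<open>R x\<close> is the trace of \<open>x\<close>
  from the field of \<open>q ^ d\<close> elements. Conversely, let \<open>R x ^ q = R x\<close> with \<open>x \<noteq> 0\<close>, and put
  \<open>u = x ^ (q ^ d - 1)\<close> and \<open>w = x ^ (q ^ (d - 1))\<close>. As \<open>n = 2 * d\<close>, we have \<open>u ^ (q ^ d) = 1 / u\<close>.
  In \<open>R x ^ q - R x = 0\<close> the sum telescopes, which leaves \<open>w * (1 - u) = x * (1 - u ^ (q + 1))\<close>.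
  Suppose \<open>u \<noteq> 1\<close>. Then both sides are nonzero, and dividing the \<open>q ^ d\<close>-th power of this equation
  by the equation itself eliminates \<open>x\<close>:
  it gives \<open>u ^ q * u ^ (q ^ (d - 1)) = u\<close> (\<open>R_fixed_imp_ratio_relations\<close>). For \<open>d = 3\<close> and \<open>d = 4\<close> this
  relation and its \<open>q\<close>-th power make \<open>u\<close> a square root and a cube root of unity respectively,
  and no such \<open>u\<close> other than 1 satisfies the relations (\<open>R_fixed_iff_3\<close>, \<open>R_fixed_iff_4\<close>).

  Finally, \<open>y ^ (q ^ (n - 1))\<close> is the only term of top degree, so \<open>(1 : 0 : 0)\<close> is the only point at
  infinity (\<open>card_proj_curve_points_one_at_infinity\<close>).
\<close>

section \<open>Additive maps and finite fields\<close>

text \<open>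
  The domain has as many elements as its image times the kernel. When upper bounds for these two
  cardinalities multiply to the size of the domain, both bounds are attained. This turns the easy
  bound on the number of roots of a polynomial into exact counts, without exhibiting a root.
\<close>

lemma card_fibres_additive:
  fixes f :: "'a::{ab_group_add, finite} \<Rightarrow> 'b::ab_group_add"
  assumes add: "\<And>x y. f (x + y) = f x + f y"
    and B: "range f \<subseteq> B" "finite B" "card B \<le> b"
    and ker: "card {x. f x = 0} \<le> a"
    and card: "CARD('a) = a * b"
    and c: "c \<in> B"
  shows "card {x. f x = c} = a"
proof -
  have fibre: "card {x. f x = f z} = card {x. f x = 0}" for z
  proof (rule sym, rule bij_betw_same_card)
    show "bij_betw (\<lambda>x. x + z) {x. f x = 0} {x. f x = f z}"
    proof (rule bij_betw_byWitness[where f' = "\<lambda>x. x - z"])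
      have "f (x - z) + f z = f x" for x
        using add[of "x - z" z] by simp
      then show "(\<lambda>x. x - z) ` {x. f x = f z} \<subseteq> {x. f x = 0}"
        by (auto simp: add_eq_0_iff2 eq_diff_eq[symmetric])
    qed (auto simp: add)
  qed
  have "CARD('a) = (\<Sum>c\<in>range f. card {x. f x = c})"
    using sum.image_gen[of "UNIV :: 'a set" "\<lambda>_. 1::nat" f] by simp
  also have "\<dots> = (\<Sum>c\<in>range f. card {x. f x = 0})"
    using fibre by (intro sum.cong) auto
  also have "\<dots> = card (range f) * card {x. f x = 0}"
    by simp
  finally have prod: "a * b = card (range f) * card {x. f x = 0}"
    using card by simp
  have range_le: "card (range f) \<le> card B"
    using B by (simp add: card_mono)
  have pos: "a * b > 0"
    using card by (metis finite_UNIV_card_ge_0 finite)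
  have eq_a: "card {x. f x = 0} = a"
  proof (rule ccontr)
    assume "card {x. f x = 0} \<noteq> a"
    with ker have "card {x. f x = 0} < a" by simp
    then have "b * card {x. f x = 0} < b * a"
      using pos by simp
    moreover have "card (range f) * card {x. f x = 0} \<le> b * card {x. f x = 0}"
      using range_le B by (intro mult_right_mono) auto
    ultimately show False using prod by (simp add: mult.commute)
  qed
  then have "card (range f) = b"
    using prod pos by (simp add: mult.commute)
  then have "range f = B"
    using B range_le by (intro card_subset_eq) auto
  then show ?thesis
    using c fibre eq_a by auto
qed

lemma power_card_field_eq_self:
  fixes x :: "'a::{field, finite}"
  shows "x ^ CARD('a) = x"
proof (cases "x = 0")
  case True
  then show ?thesis by (simp add: finite_UNIV_card_ge_0)
next
  case False
  define P where "P = (\<Prod>y\<in>UNIV - {0::'a}. y)"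
  have "P = (\<Prod>y\<in>UNIV - {0}. x * y)"
    unfolding P_def by (rule prod.reindex_bij_witness[of _ "(*) x" "\<lambda>y. y / x"]) (use False in auto)
  also have "\<dots> = x ^ (CARD('a) - 1) * P"
    by (simp add: prod.distrib P_def card_Diff_singleton)
  finally have "x ^ (CARD('a) - 1) = 1"
    by (simp add: P_def)
  moreover have "CARD('a) = Suc (CARD('a) - 1)"
    using finite_UNIV_card_ge_0[where 'a = 'a] by simp
  ultimately show ?thesis
    by (metis mult.right_neutral power_Suc)
qed

lemma CHAR_eq_of_card_prime_power:
  assumes "prime p" and card: "CARD('a::{field, finite}) = p ^ k"
  shows "CHAR('a) = p"
proof -
  have "(\<Sum>x\<in>UNIV. x :: 'a) = (\<Sum>x\<in>UNIV. x + 1)"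
    by (rule sum.reindex_bij_witness[of _ "\<lambda>x. x + 1" "\<lambda>x. x - 1"]) auto
  then have "of_nat (CARD('a)) = (0 :: 'a)"
    by (simp add: sum.distrib)
  then have "CHAR('a) dvd p ^ k"
    by (metis card of_nat_eq_0_iff_char_dvd)
  moreover have "prime CHAR('a)"
    by (rule prime_CHAR_semidom) (simp add: finite_imp_CHAR_pos)
  ultimately show ?thesis
    using \<open>prime p\<close> by (metis prime_dvd_power primes_dvd_imp_eq)
qed

lemma card_roots_le:
  fixes P :: "'a::idom poly"
  assumes "coeff P k \<noteq> 0" "degree P \<le> D" "\<And>x. x \<in> A \<Longrightarrow> poly P x = 0"
  shows "card A \<le> D"
proof -
  have "P \<noteq> 0" using assms(1) by auto
  have "card A \<le> card {x. poly P x = 0}"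
    using assms(3) poly_roots_finite[OF \<open>P \<noteq> 0\<close>] by (intro card_mono) auto
  then show ?thesis
    using card_poly_roots_bound[OF \<open>P \<noteq> 0\<close>] assms(2) by linarith
qed

text \<open>
  Only the additivity of the \<open>q\<close>-th power map is kept from the fact that \<open>q\<close> is a power of the
  characteristic.
\<close>

locale finite_field_frobenius =
  fixes q n :: nat and ty :: "'a::{field, finite} itself"
  assumes q_ge_2: "q \<ge> 2" and n_pos: "n > 0"
    and card_field: "CARD('a) = q ^ n"
    and frob_add: "\<And>a b :: 'a. (a + b) ^ q = a ^ q + b ^ q"
begin

lemma frob_pow_add: "((a::'a) + b) ^ (q ^ i) = a ^ (q ^ i) + b ^ (q ^ i)"
proof (induction i)
  case (Suc i)
  then show ?case
    by (simp add: power_mult frob_add mult.commute[of q])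
qed simp

lemma frob_pow_diff: "((a::'a) - b) ^ (q ^ i) = a ^ (q ^ i) - b ^ (q ^ i)"
  using frob_pow_add[of "a - b" b i] by simp

lemma frob_diff: "((a::'a) - b) ^ q = a ^ q - b ^ q"
  using frob_pow_diff[of a b 1] by simp

lemma frob_sum: "(\<Sum>i\<in>A. f i :: 'a) ^ q = (\<Sum>i\<in>A. f i ^ q)"
  by (induction A rule: infinite_finite_induct) (use q_ge_2 in \<open>auto simp: frob_add\<close>)

lemma frob_pow_n: "(x::'a) ^ (q ^ n) = x"
  using power_card_field_eq_self[of x] card_field by simp

lemma frob_pow_frob: "((x::'a) ^ (q ^ i)) ^ q = x ^ (q ^ Suc i)"
  by (simp add: power_mult[symmetric] mult.commute)

lemma frob_pow_frob_pow: "((x::'a) ^ (q ^ i)) ^ (q ^ j) = x ^ (q ^ (i + j))"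
  by (simp add: power_mult[symmetric] power_add)

lemma frob_sum_telescope:
  "(\<Sum>i<k. (x::'a) ^ (q ^ i)) ^ q - (\<Sum>i<k. x ^ (q ^ i)) = x ^ (q ^ k) - x"
  using sum_lessThan_telescope[of "\<lambda>i. x ^ (q ^ i)" k]
  by (simp only: frob_sum frob_pow_frob sum_subtractf[symmetric]) simp

text \<open>
  The trace is a polynomial of degree \<open>q ^ (n - 1)\<close> with values among the at most \<open>q\<close> roots of
  \<open>z ^ q - z\<close>, and \<open>q ^ (n - 1) * q\<close> is the size of the field.
\<close>

lemma card_trace_fibre:
  assumes "(c::'a) ^ q = c"
  shows "card {y::'a. (\<Sum>i<n. y ^ (q ^ i)) = c} = q ^ (n - 1)"
proof (rule card_fibres_additive[where B = "{z. z ^ q = z}" and b = q])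
  show "(\<Sum>i<n. (x + y) ^ (q ^ i)) = (\<Sum>i<n. x ^ (q ^ i)) + (\<Sum>i<n. y ^ (q ^ i))" for x y :: 'a
    by (simp add: frob_pow_add sum.distrib)
  show "range (\<lambda>y::'a. \<Sum>i<n. y ^ (q ^ i)) \<subseteq> {z. z ^ q = z}"
    using frob_sum_telescope[where k = n] by (auto simp: frob_pow_n)
  show "card {z::'a. z ^ q = z} \<le> q"
  proof (rule card_roots_le)
    show "coeff (monom 1 q - monom 1 1 :: 'a poly) q \<noteq> 0"
      using q_ge_2 by simp
    show "degree (monom 1 q - monom 1 1 :: 'a poly) \<le> q"
      using q_ge_2 by (intro degree_diff_le) (auto simp: degree_monom_eq)
  qed (simp add: poly_monom)
  show "card {y::'a. (\<Sum>i<n. y ^ (q ^ i)) = 0} \<le> q ^ (n - 1)"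
  proof (rule card_roots_le)
    let ?P = "\<Sum>i<n. monom 1 (q ^ i) :: 'a poly"
    have "coeff ?P 1 = (\<Sum>i<n. if i = 0 then 1 else 0)"
      unfolding coeff_sum coeff_monom using q_ge_2 by (intro sum.cong) auto
    then show "coeff ?P 1 \<noteq> 0"
      using n_pos by simp
    show "degree ?P \<le> q ^ (n - 1)"
    proof (rule degree_sum_le)
      fix i assume "i \<in> {..<n}"
      then show "degree (monom 1 (q ^ i) :: 'a poly) \<le> q ^ (n - 1)"
        using q_ge_2 by (auto simp: degree_monom_eq intro!: power_increasing)
    qed simp
  qed (simp add: poly_sum poly_monom)
  show "CARD('a) = q ^ (n - 1) * q"
    using n_pos card_field by (metis power_minus_mult)
qed (use assms in auto)

text \<open>
  The map \<open>x \<mapsto> x ^ (q ^ d) - x\<close> sends the field into the roots of \<open>z ^ (q ^ d) + z\<close>, because the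
  \<open>q ^ d\<close>-th power map is an involution. Kernel and image thus have at most \<open>q ^ d\<close> elements each, and
  the field has \<open>q ^ d * q ^ d\<close>.
\<close>

lemma card_fixed_half:
  assumes n: "n = 2 * d"
  shows "card {x::'a. x ^ (q ^ d) = x} = q ^ d"
proof -
  have d: "q ^ d \<ge> 2"
    using n n_pos q_ge_2 by (metis mult_pos_pos nat_0_less_mult_iff order_trans self_le_power one_le_numeral)
  have "card {x::'a. x ^ (q ^ d) - x = 0} = q ^ d"
  proof (rule card_fibres_additive[where B = "{z. z ^ (q ^ d) = - z}" and b = "q ^ d"])
    show "(x + y) ^ (q ^ d) - (x + y) = (x ^ (q ^ d) - x) + (y ^ (q ^ d) - y)" for x y :: 'a
      by (simp add: frob_pow_add)
    show "range (\<lambda>x::'a. x ^ (q ^ d) - x) \<subseteq> {z. z ^ (q ^ d) = - z}"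
      using frob_pow_n n by (auto simp: frob_pow_diff frob_pow_frob_pow mult_2)
    show "card {z::'a. z ^ (q ^ d) = - z} \<le> q ^ d"
    proof (rule card_roots_le)
      show "coeff (monom 1 (q ^ d) + monom 1 1 :: 'a poly) (q ^ d) \<noteq> 0"
        using d by auto
      show "degree (monom 1 (q ^ d) + monom 1 1 :: 'a poly) \<le> q ^ d"
        using d by (intro degree_add_le) (auto simp: degree_monom_eq)
    qed (simp add: poly_monom)
    show "card {x::'a. x ^ (q ^ d) - x = 0} \<le> q ^ d"
    proof (rule card_roots_le)
      show "coeff (monom 1 (q ^ d) - monom 1 1 :: 'a poly) (q ^ d) \<noteq> 0"
        using d by auto
      show "degree (monom 1 (q ^ d) - monom 1 1 :: 'a poly) \<le> q ^ d"
        using d by (intro degree_diff_le) (auto simp: degree_monom_eq)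
    qed (simp add: poly_monom)
    show "CARD('a) = q ^ d * q ^ d"
      using card_field n by (simp add: mult_2 power_add)
  qed (use q_ge_2 in \<open>auto simp: power_0_left\<close>)
  then show ?thesis by simp
qed

section \<open>When R takes a value in the base field\<close>

definition R :: "nat \<Rightarrow> 'a \<Rightarrow> 'a" where
  "R d x = (\<Sum>i<d - 1. x ^ (q ^ i)) + x ^ (q ^ (d - 1) + q ^ d - 1)"

text \<open>
  On the subfield with \<open>q ^ d\<close> elements, \<open>R d\<close> is the trace to the subfield fixed by \<open>z \<mapsto> z ^ q\<close>.
\<close>

lemma R_fixed_if_subfield:
  assumes "d \<ge> 1" and x: "x ^ (q ^ d) = (x::'a)"
  shows "R d x ^ q = R d x"
proof -
  have "q ^ (d - 1) + q ^ d - 1 = q ^ (d - 1) + (q ^ d - 1)"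
    using q_ge_2 by simp
  moreover have "x * x ^ (q ^ d - 1) = x"
    using x q_ge_2 by (simp add: power_Suc[symmetric] del: power_Suc)
  moreover have "x ^ (q ^ (d - 1)) = x ^ (q ^ (d - 1) - 1) * x"
    using q_ge_2 by (simp add: power_Suc2[symmetric] del: power_Suc power_Suc2)
  ultimately have "x ^ (q ^ (d - 1) + q ^ d - 1) = x ^ (q ^ (d - 1))"
    by (metis power_add mult.assoc)
  then have "R d x = (\<Sum>i<d. x ^ (q ^ i))"
    using assms(1) sum.lessThan_Suc[of "\<lambda>i. x ^ (q ^ i)" "d - 1"] by (simp add: R_def)
  then show ?thesis
    using frob_sum_telescope[of x d] x by simp
qed

text \<open>
  The numbers \<open>u ^ (q ^ i)\<close> are the ratios \<open>x ^ (q ^ (d + i)) / x ^ (q ^ i)\<close>. The point is that \<open>x\<close> itself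
  disappears from the relations, so that what remains is a condition on \<open>u\<close> alone.
\<close>

lemma R_fixed_imp_ratio_relations:
  fixes x :: 'a
  assumes n: "n = 2 * d" and d: "d \<ge> 1" and x0: "x \<noteq> 0" and R: "R d x ^ q = R d x"
    and u: "u = x ^ (q ^ d) / x" and "u \<noteq> 1"
  shows "u * u ^ q \<noteq> 1" "u ^ q * u ^ (q ^ (d - 1)) = u" "u ^ (q ^ d) = 1 / u" "u \<noteq> 0"
proof -
  define w where "w = x ^ (q ^ (d - 1))"
  define t where "t = x ^ (q ^ (d - 1) + q ^ d - 1)"
  have xd: "x ^ (q ^ d) = x * u"
    using x0 u by simp
  have wq: "w ^ q = x * u"
    using d by (simp add: w_def frob_pow_frob xd[symmetric] del: power_Suc)
  have u0: "u \<noteq> 0" and w0: "w \<noteq> 0"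
    using x0 u w_def by auto
  have uqd: "u ^ (q ^ d) = 1 / u"
    using frob_pow_n[of x] n
    by (simp add: u power_divide frob_pow_frob_pow mult_2)
  have "t * x = x ^ Suc (q ^ (d - 1) + q ^ d - 1)"
    by (simp add: t_def)
  also have "Suc (q ^ (d - 1) + q ^ d - 1) = q ^ (d - 1) + q ^ d"
    using q_ge_2 by simp
  finally have "t * x = w * (x * u)"
    by (simp add: power_add w_def xd)
  then have t: "t = w * u"
    using x0 by simp
  have tq: "t ^ q = x * u * u ^ q"
    by (simp add: t power_mult_distrib wq)
  have Rt: "R d x = (\<Sum>i<d - 1. x ^ (q ^ i)) + t"
    by (simp add: R_def t_def)
  have "0 = R d x ^ q - R d x"
    using R by simp
  also have "\<dots> = ((\<Sum>i<d - 1. x ^ (q ^ i)) ^ q - (\<Sum>i<d - 1. x ^ (q ^ i))) + (t ^ q - t)"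
    by (simp add: Rt frob_add)
  also have "\<dots> = (w - x) + (x * u * u ^ q - w * u)"
    unfolding frob_sum_telescope tq w_def[symmetric] by (simp add: t)
  finally have E: "w * (1 - u) = x * (1 - u * u ^ q)"
    by (simp add: algebra_simps)
  show ne: "u * u ^ q \<noteq> 1"
    using E w0 \<open>u \<noteq> 1\<close> by auto
  have wd: "w ^ (q ^ d) = w * u ^ (q ^ (d - 1))"
  proof -
    have "w ^ (q ^ d) = (x ^ (q ^ d)) ^ (q ^ (d - 1))"
      by (simp add: w_def frob_pow_frob_pow add.commute)
    then show ?thesis
      by (simp add: xd power_mult_distrib w_def)
  qed
  have uqqd: "(u ^ q) ^ (q ^ d) = 1 / u ^ q"
    by (metis mult.commute power_mult uqd power_one_over)
  \<comment> \<open>The \<open>q ^ d\<close>-th power replaces \<open>u\<close> by its inverse, so it changes the two factors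
      \<open>1 - u\<close> and \<open>1 - u * u ^ q\<close> in \<open>E\<close> only by monomials, and \<open>E\<close> can be divided out.\<close>
  have "(w * (1 - u)) ^ (q ^ d) = (x * (1 - u * u ^ q)) ^ (q ^ d)"
    using E by simp
  then have "w * u ^ (q ^ (d - 1)) * (1 - 1 / u) = x * u * (1 - 1 / u * (1 / u ^ q))"
    by (simp only: power_mult_distrib frob_pow_diff wd xd uqd uqqd power_one)
  moreover have "w * (1 - u) * (a * v) = x * (1 - u * v) * u"
    if "w * a * (1 - 1 / u) = x * u * (1 - 1 / u * (1 / v))" "v \<noteq> 0" for a v
  proof -
    have "u * v * (w * a * (1 - 1 / u)) = - (w * (1 - u) * (a * v))"
      using u0 by (simp add: field_simps)
    moreover have "u * v * (x * u * (1 - 1 / u * (1 / v))) = - (x * (1 - u * v) * u)"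
      using u0 \<open>v \<noteq> 0\<close> by (simp add: field_simps)
    ultimately show ?thesis
      using that(1) by simp
  qed
  ultimately have "w * (1 - u) * (u ^ (q ^ (d - 1)) * u ^ q) = x * (1 - u * u ^ q) * u"
    using u0 by simp
  then have "(x * (1 - u * u ^ q)) * (u ^ (q ^ (d - 1)) * u ^ q) = (x * (1 - u * u ^ q)) * u"
    by (simp add: E)
  then show "u ^ q * u ^ (q ^ (d - 1)) = u"
    using x0 ne by (simp add: mult.commute)
  show "u ^ (q ^ d) = 1 / u" "u \<noteq> 0"
    by (fact uqd, fact u0)
qed

lemma frob_inj: "(a::'a) ^ q = b ^ q \<Longrightarrow> a = b"
  using frob_diff[of a b] by simp

lemma frob_eq_1_iff: "(a::'a) ^ q = 1 \<longleftrightarrow> a = 1"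
  using frob_inj[of a 1] by auto

text \<open>
  Taking the \<open>q\<close>-th power of \<open>u ^ q * u ^ (q ^ 2) = u\<close> yields \<open>u ^ (q ^ 2) = u * u ^ q\<close>, whence
  \<open>(u ^ q) ^ 2 = 1\<close> and \<open>u = -1\<close>. But then \<open>u * u ^ q = 1\<close>, which the relations forbid.
\<close>

lemma R_fixed_iff_3:
  assumes n: "n = 6"
  shows "R 3 x ^ q = R 3 x \<longleftrightarrow> x ^ (q ^ 3) = (x::'a)"
proof
  assume R: "R 3 x ^ q = R 3 x"
  show "x ^ (q ^ 3) = x"
  proof (cases "x = 0")
    case False
    define u where "u = x ^ (q ^ 3) / x"
    have "u = 1"
    proof (rule ccontr)
      assume "u \<noteq> 1"
      then have ne: "u * u ^ q \<noteq> 1" and rel: "u ^ q * u ^ (q ^ 2) = u"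
        and u3: "u ^ (q ^ 3) = 1 / u" and u0: "u \<noteq> 0"
        using R_fixed_imp_ratio_relations[of 3 x u] n False R u_def by simp_all
      have "(u ^ q * u ^ (q ^ 2)) ^ q = u ^ (q ^ 2) * u ^ (q ^ 3)"
        using frob_pow_frob[of u 1] frob_pow_frob[of u 2]
        by (simp add: power_mult_distrib eval_nat_numeral)
      then have "u ^ (q ^ 2) = u * u ^ q"
        using u0 by (simp add: rel u3 field_simps)
      then have "u * (u ^ q)\<^sup>2 = u * 1"
        using rel by (simp add: power2_eq_square mult_ac)
      then have "(u\<^sup>2) ^ q = 1"
        using u0 by (simp add: power_mult[symmetric] mult.commute)
      then have "u = -1"
        using \<open>u \<noteq> 1\<close> by (simp add: frob_eq_1_iff power2_eq_1_iff)
      moreover have "(-1 :: 'a) ^ q = -1"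
        using frob_diff[of 0 1] q_ge_2 by simp
      ultimately show False
        using ne by simp
    qed
    then show ?thesis
      using False by (simp add: u_def)
  qed (use q_ge_2 in simp)
qed (rule R_fixed_if_subfield, simp_all)

text \<open>
  The \<open>q\<close>-th power of \<open>u ^ q * u ^ (q ^ 3) = u\<close> yields \<open>u ^ (q ^ 2) = u * u ^ q\<close>, and one more \<open>q\<close>-th power
  \<open>u ^ (q ^ 3) = u * (u ^ q) ^ 2\<close>, whence \<open>(u ^ q) ^ 3 = 1\<close> and \<open>u ^ 3 = 1\<close>. So \<open>u ^ q\<close> depends only on
  \<open>q mod 3\<close>, and each residue is impossible: \<open>u ^ q = 1\<close> gives \<open>u = 1\<close>, \<open>u ^ q = u\<close> gives \<open>u = u * u\<close>, and
  \<open>u ^ q = u ^ 2\<close> gives \<open>u * u ^ q = 1\<close>.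
\<close>

lemma R_fixed_iff_4:
  assumes n: "n = 8"
  shows "R 4 x ^ q = R 4 x \<longleftrightarrow> x ^ (q ^ 4) = (x::'a)"
proof
  assume R: "R 4 x ^ q = R 4 x"
  show "x ^ (q ^ 4) = x"
  proof (cases "x = 0")
    case False
    define u where "u = x ^ (q ^ 4) / x"
    have "u = 1"
    proof (rule ccontr)
      assume "u \<noteq> 1"
      then have ne: "u * u ^ q \<noteq> 1" and rel: "u ^ q * u ^ (q ^ 3) = u"
        and u4: "u ^ (q ^ 4) = 1 / u" and u0: "u \<noteq> 0"
        using R_fixed_imp_ratio_relations[of 4 x u] n False R u_def by simp_all
      have frob: "(u ^ q) ^ q = u ^ (q ^ 2)" "(u ^ (q ^ 2)) ^ q = u ^ (q ^ 3)"
        "(u ^ (q ^ 3)) ^ q = u ^ (q ^ 4)"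
        using frob_pow_frob[of u 1] frob_pow_frob[of u 2] frob_pow_frob[of u 3]
        by (simp_all add: eval_nat_numeral)
      have "(u ^ q * u ^ (q ^ 3)) ^ q = u ^ (q ^ 2) * u ^ (q ^ 4)"
        by (simp only: power_mult_distrib frob)
      then have u2: "u ^ (q ^ 2) = u * u ^ q"
        using u0 by (simp add: rel u4 field_simps)
      then have "(u ^ (q ^ 2)) ^ q = u ^ q * (u * u ^ q)"
        by (simp add: power_mult_distrib frob)
      then have "u * (u ^ q) ^ 3 = u * 1"
        using rel by (simp add: frob power3_eq_cube mult_ac)
      then have "(u ^ 3) ^ q = 1"
        using u0 by (simp add: power_mult[symmetric] mult.commute)
      then have cube: "u ^ 3 = 1"
        by (simp add: frob_eq_1_iff)
      have "u ^ q = u ^ (3 * (q div 3) + q mod 3)"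
        by simp
      also have "\<dots> = u ^ (q mod 3)"
        by (simp only: power_add power_mult cube power_one mult_1)
      finally have uq: "u ^ q = u ^ (q mod 3)" .
      consider "q mod 3 = 0" | "q mod 3 = 1" | "q mod 3 = 2"
        by linarith
      then show False
      proof cases
        case 1
        with uq have "u ^ q = 1" by simp
        then show False
          using \<open>u \<noteq> 1\<close> by (simp add: frob_eq_1_iff)
      next
        case 2
        with uq have "u ^ q = u" by simp
        then have "u = u * u"
          using u2 frob(1) by simp
        then show False
          using u0 \<open>u \<noteq> 1\<close> by simp
      next
        case 3
        then show False
          using ne uq cube by (simp add: power2_eq_square power3_eq_cube mult.assoc)
      qed
    qed
    then show ?thesis
      using False by (simp add: u_def)
  qed (use q_ge_2 in simp)
qed (rule R_fixed_if_subfield, simp_all)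

lemma card_affine_points:
  assumes n: "n = 2 * d" and R: "\<And>x. R d x ^ q = R d x \<longleftrightarrow> x ^ (q ^ d) = x"
  shows "card {(x, y). (\<Sum>i<n. y ^ (q ^ i)) = R d x} = q ^ (n - 1 + d)"
proof -
  let ?K = "{x::'a. x ^ (q ^ d) = x}"
  have fixed: "(\<Sum>i<n. y ^ (q ^ i)) ^ q = (\<Sum>i<n. (y::'a) ^ (q ^ i))" for y
    using frob_sum_telescope[of y n] by (simp add: frob_pow_n)
  have "{(x, y). (\<Sum>i<n. y ^ (q ^ i)) = R d x} = Sigma ?K (\<lambda>x. {y. (\<Sum>i<n. y ^ (q ^ i)) = R d x})"
  proof -
    have "R d x ^ q = R d x" if "(\<Sum>i<n. y ^ (q ^ i)) = R d x" for x y
      using fixed[of y] that by simp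
    then show ?thesis
      by (auto simp: R)
  qed
  moreover have "card {y. (\<Sum>i<n. y ^ (q ^ i)) = R d x} = q ^ (n - 1)" if "x \<in> ?K" for x
    using card_trace_fibre that R by simp
  ultimately have "card {(x, y). (\<Sum>i<n. y ^ (q ^ i)) = R d x} = card ?K * q ^ (n - 1)"
    by simp
  then show ?thesis
    by (simp add: card_fixed_half[OF n] power_add)
qed

end

section \<open>Projective points of a plane curve\<close>

lemma equiv_proj_rel: "equiv {v :: 'l::field \<times> 'l \<times> 'l. v \<noteq> (0, 0, 0)} proj_rel"
proof (rule equivI)
  show "refl_on {v :: 'l \<times> 'l \<times> 'l. v \<noteq> (0, 0, 0)} proj_rel"
    by (auto simp: refl_on_def proj_rel_def intro!: exI[of _ 1])
  show "sym (proj_rel :: (('l \<times> 'l \<times> 'l) \<times> ('l \<times> 'l \<times> 'l)) set)"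
  proof (rule symI)
    fix v w :: "'l \<times> 'l \<times> 'l"
    assume "(v, w) \<in> proj_rel"
    then obtain X Y Z c where "v = (X, Y, Z)" "w = (c * X, c * Y, c * Z)" "c \<noteq> 0" "v \<noteq> (0, 0, 0)"
      by (auto simp: proj_rel_def)
    then show "(w, v) \<in> proj_rel"
      by (auto simp: proj_rel_def intro!: exI[of _ "inverse c"])
  qed
  show "trans (proj_rel :: (('l \<times> 'l \<times> 'l) \<times> ('l \<times> 'l \<times> 'l)) set)"
  proof (rule transI)
    fix u v w :: "'l \<times> 'l \<times> 'l"
    assume "(u, v) \<in> proj_rel" "(v, w) \<in> proj_rel"
    from this(1) obtain X Y Z c where u: "u = (X, Y, Z)" "u \<noteq> (0, 0, 0)"
      and v: "v = (c * X, c * Y, c * Z)" and "c \<noteq> 0"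
      by (auto simp: proj_rel_def)
    from \<open>(v, w) \<in> proj_rel\<close> obtain c' where "w = (c' * (c * X), c' * (c * Y), c' * (c * Z))" "c' \<noteq> 0"
      unfolding v by (auto simp: proj_rel_def)
    with u \<open>c \<noteq> 0\<close> show "(u, w) \<in> proj_rel"
      by (simp add: proj_rel_def mult.assoc) (metis mult_eq_0_iff mult.assoc)
  qed
qed (auto simp: proj_rel_def)

definition poly_support :: "'k::field poly poly \<Rightarrow> (nat \<times> nat) set" where
  "poly_support f = {(i, j). coeff (coeff f j) i \<noteq> 0}"

lemma poly_support_subset:
  "poly_support f \<subseteq> (\<lambda>(j, i). (i, j)) ` (SIGMA j:{..degree f}. {..degree (coeff f j)})"
proof
  fix s assume "s \<in> poly_support f"
  then obtain i j where s: "s = (i, j)" and ij: "coeff (coeff f j) i \<noteq> 0"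
    by (auto simp: poly_support_def)
  then have "coeff f j \<noteq> 0" by auto
  then have "(j, i) \<in> (SIGMA j:{..degree f}. {..degree (coeff f j)})"
    using ij by (simp add: le_degree)
  then show "s \<in> (\<lambda>(j, i). (i, j)) ` (SIGMA j:{..degree f}. {..degree (coeff f j)})"
    using s by (auto intro!: image_eqI[of _ _ "(j, i)"])
qed

lemma finite_poly_support: "finite (poly_support f)"
  using poly_support_subset by (rule finite_subset) auto

lemma total_degree_eq_Max: "total_degree f = Max ((\<lambda>(i, j). i + j) ` poly_support f)"
  unfolding total_degree_def poly_support_def by (rule arg_cong[of _ _ Max]) auto

lemma le_total_degree: "(i, j) \<in> poly_support f \<Longrightarrow> i + j \<le> total_degree f"
  unfolding total_degree_eq_Max using finite_poly_support[of f] by (intro Max_ge) auto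

lemma homogenization_eval_support:
  assumes "\<iota> 0 = 0"
  shows "homogenization_eval \<iota> f X Y Z =
    (\<Sum>(i, j)\<in>poly_support f. \<iota> (coeff (coeff f j) i) * X ^ i * Y ^ j * Z ^ (total_degree f - i - j))"
    (is "_ = sum ?t _")
proof -
  let ?B = "SIGMA j:{..degree f}. {..degree (coeff f j)}"
  have "homogenization_eval \<iota> f X Y Z = (\<Sum>(j, i)\<in>?B. ?t (i, j))"
    by (simp add: homogenization_eval_def sum.Sigma)
  also have "\<dots> = sum ?t ((\<lambda>(j, i). (i, j)) ` ?B)"
    by (subst sum.reindex) (auto simp: inj_on_def case_prod_unfold)
  also have "\<dots> = sum ?t (poly_support f)"
    using poly_support_subset[of f] assms
    by (intro sum.mono_neutral_right) (auto simp: poly_support_def)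
  finally show ?thesis .
qed

text \<open>
  Since exponents are truncated differences, homogeneity rests on \<open>i + j\<close> never exceeding the total
  degree on the support.
\<close>

lemma homogenization_eval_scale:
  assumes "\<iota> 0 = 0"
  shows "homogenization_eval \<iota> f (c * X) (c * Y) (c * Z) =
    c ^ total_degree f * homogenization_eval \<iota> f X Y Z"
  unfolding homogenization_eval_support[where \<iota> = \<iota>, OF assms] sum_distrib_left
proof (intro sum.cong refl, clarify)
  fix i j assume "(i, j) \<in> poly_support f"
  then have "total_degree f = i + j + (total_degree f - i - j)"
    using le_total_degree by fastforce
  then have "c ^ total_degree f = c ^ i * c ^ j * c ^ (total_degree f - i - j)"
    by (metis power_add)
  then show "\<iota> (coeff (coeff f j) i) * (c * X) ^ i * (c * Y) ^ j * (c * Z) ^ (total_degree f - i - j) =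
    c ^ total_degree f *
      (\<iota> (coeff (coeff f j) i) * X ^ i * Y ^ j * Z ^ (total_degree f - i - j))"
    by (simp add: power_mult_distrib mult_ac)
qed

text \<open>
  Vanishing at one representative suffices, by homogeneity.
\<close>

lemma proj_class_mem_curve_iff:
  assumes "\<iota> 0 = 0" and "(X, Y, Z) \<noteq> (0, 0, 0)"
  shows "proj_rel `` {(X, Y, Z)} \<in> proj_curve_points \<iota> f \<longleftrightarrow> homogenization_eval \<iota> f X Y Z = 0"
proof
  assume "proj_rel `` {(X, Y, Z)} \<in> proj_curve_points \<iota> f"
  moreover have "(X, Y, Z) \<in> proj_rel `` {(X, Y, Z)}"
    using equiv_class_self[OF equiv_proj_rel] assms by blast
  ultimately have "case (X, Y, Z) of (X, Y, Z) \<Rightarrow> homogenization_eval \<iota> f X Y Z = 0"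
    unfolding proj_curve_points_def by blast
  then show "homogenization_eval \<iota> f X Y Z = 0"
    by simp
next
  assume "homogenization_eval \<iota> f X Y Z = 0"
  moreover have "proj_rel `` {(X, Y, Z)} \<in> proj_plane"
    using assms(2) by (auto simp: proj_plane_def intro: quotientI)
  ultimately show "proj_rel `` {(X, Y, Z)} \<in> proj_curve_points \<iota> f"
    by (auto simp: proj_curve_points_def proj_rel_def homogenization_eval_scale[where \<iota> = \<iota>, OF assms(1)])
qed

text \<open>
  A point with \<open>Z \<noteq> 0\<close> has a unique representative with \<open>Z = 1\<close>; the hypothesis on \<open>Z = 0\<close> leaves only
  \<open>(1 : 0 : 0)\<close> on the line at infinity.
\<close>

lemma card_proj_curve_points_one_at_infinity:
  fixes \<iota> :: "'k::field \<Rightarrow> 'l::{field, finite}"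
  assumes \<iota>: "\<iota> 0 = 0"
    and infinity: "\<And>X Y. homogenization_eval \<iota> f X Y 0 = 0 \<longleftrightarrow> Y = 0"
  shows "card (proj_curve_points \<iota> f) = 1 + card {(x, y). homogenization_eval \<iota> f x y 1 = 0}"
proof -
  let ?A = "{(x, y). homogenization_eval \<iota> f x y 1 = 0}"
  let ?cls = "\<lambda>v :: 'l \<times> 'l \<times> 'l. proj_rel `` {v}"
  let ?aff = "\<lambda>(x, y). ?cls (x, y, 1)"
  have cls_eq: "?cls v = ?cls w \<longleftrightarrow> (v, w) \<in> proj_rel" if "v \<noteq> (0, 0, 0)" "w \<noteq> (0, 0, 0)" for v w
    using eq_equiv_class_iff[OF equiv_proj_rel, of v w] that by simp
  have "proj_curve_points \<iota> f = insert (?cls (1, 0, 0)) (?aff ` ?A)"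
  proof (intro equalityI subsetI)
    fix P assume P: "P \<in> proj_curve_points \<iota> f"
    then obtain X Y Z where P_eq: "P = ?cls (X, Y, Z)" and nz: "(X, Y, Z) \<noteq> (0, 0, 0)"
      by (auto simp: proj_curve_points_def proj_plane_def elim!: quotientE)
    have F: "homogenization_eval \<iota> f X Y Z = 0"
      using P nz by (simp only: P_eq proj_class_mem_curve_iff[where \<iota> = \<iota>, OF \<iota> nz])
    show "P \<in> insert (?cls (1, 0, 0)) (?aff ` ?A)"
    proof (cases "Z = 0")
      case True
      with F infinity nz have "Y = 0" "X \<noteq> 0" by auto
      then have "P = ?cls (1, 0, 0)"
        unfolding P_eq using True
        by (subst cls_eq) (auto simp: proj_rel_def intro!: exI[of _ "inverse X"])
      then show ?thesis by simp
    next
      case False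
      then have "P = ?aff (X / Z, Y / Z)"
        unfolding P_eq
        by (simp, subst cls_eq) (auto simp: proj_rel_def field_simps intro!: exI[of _ "inverse Z"])
      moreover have "homogenization_eval \<iota> f (X / Z) (Y / Z) 1 = 0"
        using homogenization_eval_scale[of \<iota> f "inverse Z" X Y Z, OF \<iota>] F False
        by (simp add: divide_inverse mult.commute)
      ultimately show ?thesis by blast
    qed
  next
    fix P assume "P \<in> insert (?cls (1, 0, 0)) (?aff ` ?A)"
    then show "P \<in> proj_curve_points \<iota> f"
      using infinity by (auto simp: proj_class_mem_curve_iff[where \<iota> = \<iota>, OF \<iota>])
  qed
  moreover have "?cls (1, 0, 0) \<notin> ?aff ` ?A"
  proof -
    have "?cls (1, 0, 0) \<noteq> ?cls (x, y, 1)" for x y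
      by (subst cls_eq) (auto simp: proj_rel_def)
    then show ?thesis by auto
  qed
  moreover have "inj_on ?aff ?A"
  proof -
    have "x = x' \<and> y = y'" if "?cls (x, y, 1) = ?cls (x', y', 1)" for x y x' y'
      using that by (subst (asm) cls_eq) (auto simp: proj_rel_def)
    then show ?thesis by (auto simp: inj_on_def)
  qed
  ultimately show ?thesis
    by (simp add: card_image)
qed

section \<open>The curve C\<close>

lemma coeff_sum_monom_inj:
  assumes "finite A" "inj_on e A"
  shows "coeff (\<Sum>a\<in>A. monom (1::'b::comm_semiring_1) (e a)) i = of_bool (i \<in> e ` A)"
proof -
  have "coeff (\<Sum>a\<in>A. monom (1::'b) (e a)) i = (\<Sum>k\<in>e ` A. if k = i then 1 else 0)"
    by (simp add: coeff_sum sum.reindex[OF assms(2)])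
  then show ?thesis
    using assms(1) by simp
qed

lemma field_embedding_0:
  assumes "field_embedding \<iota>"
  shows "\<iota> 0 = 0"
proof -
  have "\<iota> (0 + 0) = \<iota> 0 + \<iota> 0"
    using assms unfolding field_embedding_def by blast
  then show ?thesis
    unfolding add_0_right by (metis add_cancel_right_right)
qed

lemma field_embedding_1: "field_embedding \<iota> \<Longrightarrow> \<iota> 1 = 1"
  unfolding field_embedding_def by blast

lemma field_embedding_minus_1:
  assumes "field_embedding \<iota>"
  shows "\<iota> (- 1) = - 1"
proof -
  have "\<iota> (1 + - 1) = \<iota> 1 + \<iota> (- 1)"
    using assms unfolding field_embedding_def by blast
  then show ?thesis
    using field_embedding_0[OF assms] field_embedding_1[OF assms]
    by (simp add: minus_unique)
qed

context
  fixes q n d :: nat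
  assumes q: "q \<ge> 2" and d: "d \<ge> 2" and nd: "d + 2 \<le> n"
begin

definition R_exponents :: "nat set" where
  "R_exponents = insert (q ^ (d - 1) + q ^ d - 1) ((^) q ` {..<d - 1})"

definition C_exponents :: "nat set" where
  "C_exponents = (^) q ` {..<n}"

lemma inj_power_q: "inj_on ((^) q) A"
  using q by (auto simp: inj_on_def)

lemma R_top_exponent_gt: "i < d - 1 \<Longrightarrow> q ^ i < q ^ (d - 1) + q ^ d - 1"
proof -
  assume "i < d - 1"
  then have "q ^ i < q ^ (d - 1)"
    using q by (intro power_strict_increasing) auto
  moreover have "q \<le> q ^ d"
    using q d by (intro self_le_power) auto
  ultimately show ?thesis
    using q by linarith
qed

lemma coeff_R_poly: "coeff (R_poly q d :: 'k::field poly) i = of_bool (i \<in> R_exponents)"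
proof -
  have "q ^ (d - 1) + q ^ d - 1 \<notin> (^) q ` {..<d - 1}"
    using R_top_exponent_gt by fastforce
  then show ?thesis
    by (auto simp: R_poly_def R_exponents_def coeff_sum_monom_inj[OF _ inj_power_q])
qed

lemma coeff_C_poly:
  "coeff (coeff (C_poly q n d :: 'k::field poly poly) j) i =
    of_bool (i = 0 \<and> j \<in> C_exponents) - of_bool (i \<in> R_exponents \<and> j = 0)"
  by (cases j) (auto simp: C_poly_def C_exponents_def coeff_sum_monom_inj[OF _ inj_power_q]
      coeff_R_poly coeff_pCons)

lemma exponents_pos: "0 \<notin> R_exponents" "0 \<notin> C_exponents"
  using q power_increasing[of 1 d q] d by (auto simp: R_exponents_def C_exponents_def)

text \<open>
  This is what makes \<open>y ^ (q ^ (n - 1))\<close> the term of highest degree; the largest exponent of \<open>R\<close> lies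
  below \<open>2 * q ^ d \<le> q ^ (d + 1)\<close>.
\<close>

lemma R_exponents_less: "i \<in> R_exponents \<Longrightarrow> i < q ^ (n - 1)"
proof -
  have "q ^ (d - 1) + q ^ d - 1 < 2 * q ^ d"
  proof -
    have "q ^ (d - 1) \<le> q ^ d"
      using q by (intro power_increasing) auto
    moreover have "q ^ d > 0"
      using q by simp
    ultimately show ?thesis by linarith
  qed
  also have "\<dots> \<le> q ^ Suc d"
    using q by simp
  also have "\<dots> \<le> q ^ (n - 1)"
    using q nd by (intro power_increasing) auto
  finally have "q ^ (d - 1) + q ^ d - 1 < q ^ (n - 1)" .
  then show "i \<in> R_exponents \<Longrightarrow> i < q ^ (n - 1)"
    using R_top_exponent_gt by (fastforce simp: R_exponents_def)
qed

lemma poly_support_C_poly: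
  "poly_support (C_poly q n d :: 'k::field poly poly) = {0} \<times> C_exponents \<union> R_exponents \<times> {0}"
  using exponents_pos by (auto simp: poly_support_def coeff_C_poly)

lemma total_degree_C_poly: "total_degree (C_poly q n d :: 'k::field poly poly) = q ^ (n - 1)"
  unfolding total_degree_eq_Max poly_support_C_poly
proof (rule Max_eqI)
  fix k assume "k \<in> (\<lambda>(i, j). i + j) ` ({0} \<times> C_exponents \<union> R_exponents \<times> {0})"
  then show "k \<le> q ^ (n - 1)"
    using R_exponents_less q by (auto simp: C_exponents_def less_imp_le intro!: power_increasing)
next
  show "q ^ (n - 1) \<in> (\<lambda>(i, j). i + j) ` ({0} \<times> C_exponents \<union> R_exponents \<times> {0})"
    using nd by (intro image_eqI[of _ _ "(0, q ^ (n - 1))"]) (auto simp: C_exponents_def)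
qed (simp add: C_exponents_def R_exponents_def)

lemma homogenization_eval_C_poly:
  assumes \<iota>: "field_embedding \<iota>"
  shows "homogenization_eval \<iota> (C_poly q n d) X Y Z =
    (\<Sum>j\<in>C_exponents. Y ^ j * Z ^ (q ^ (n - 1) - j)) - (\<Sum>i\<in>R_exponents. X ^ i * Z ^ (q ^ (n - 1) - i))"
proof -
  let ?t = "\<lambda>(i, j). \<iota> (coeff (coeff (C_poly q n d) j) i) * X ^ i * Y ^ j * Z ^ (q ^ (n - 1) - i - j)"
  have "homogenization_eval \<iota> (C_poly q n d) X Y Z =
      sum ?t ({0} \<times> C_exponents) + sum ?t (R_exponents \<times> {0})"
    unfolding homogenization_eval_support[where \<iota> = \<iota>, OF field_embedding_0[OF \<iota>]]
      poly_support_C_poly total_degree_C_poly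
    using exponents_pos
    by (intro sum.union_disjoint) (auto simp: C_exponents_def R_exponents_def)
  also have "sum ?t ({0} \<times> C_exponents) = (\<Sum>j\<in>C_exponents. ?t (0, j))"
    by (simp add: sum.cartesian_product[symmetric])
  also have "\<dots> = (\<Sum>j\<in>C_exponents. Y ^ j * Z ^ (q ^ (n - 1) - j))"
    using exponents_pos by (intro sum.cong) (auto simp: coeff_C_poly field_embedding_1[OF \<iota>])
  also have "sum ?t (R_exponents \<times> {0}) = (\<Sum>i\<in>R_exponents. ?t (i, 0))"
    by (simp add: sum.cartesian_product[symmetric])
  also have "\<dots> = - (\<Sum>i\<in>R_exponents. X ^ i * Z ^ (q ^ (n - 1) - i))"
    unfolding sum_negf[symmetric]
    using exponents_pos by (intro sum.cong) (auto simp: coeff_C_poly field_embedding_minus_1[OF \<iota>])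
  finally show ?thesis by simp
qed

lemma homogenization_eval_C_poly_infinity:
  assumes \<iota>: "field_embedding \<iota>"
  shows "homogenization_eval \<iota> (C_poly q n d) X Y 0 = Y ^ (q ^ (n - 1))"
proof -
  have "(\<Sum>j\<in>C_exponents. Y ^ j * 0 ^ (q ^ (n - 1) - j)) = (\<Sum>j\<in>{q ^ (n - 1)}. Y ^ j)"
  proof (rule sum.mono_neutral_cong_right)
    show "\<forall>j\<in>C_exponents - {q ^ (n - 1)}. Y ^ j * 0 ^ (q ^ (n - 1) - j) = 0"
    proof
      fix j assume "j \<in> C_exponents - {q ^ (n - 1)}"
      then obtain a where "a < n" "j = q ^ a" "a \<noteq> n - 1"
        by (auto simp: C_exponents_def)
      then have "j < q ^ (n - 1)"
        using q by (auto intro!: power_strict_increasing)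
      then show "Y ^ j * 0 ^ (q ^ (n - 1) - j) = 0"
        by (simp add: power_0_left)
    qed
  qed (use nd in \<open>auto simp: C_exponents_def\<close>)
  moreover have "(\<Sum>i\<in>R_exponents. X ^ i * 0 ^ (q ^ (n - 1) - i)) = 0"
    using R_exponents_less by (intro sum.neutral) (fastforce simp: power_0_left)
  ultimately show ?thesis
    by (simp add: homogenization_eval_C_poly[OF \<iota>])
qed

lemma homogenization_eval_C_poly_affine:
  assumes \<iota>: "field_embedding \<iota>"
  shows "homogenization_eval \<iota> (C_poly q n d) X Y 1 =
    (\<Sum>i<n. Y ^ (q ^ i)) - ((\<Sum>i<d - 1. X ^ (q ^ i)) + X ^ (q ^ (d - 1) + q ^ d - 1))"
proof -
  have "q ^ (d - 1) + q ^ d - 1 \<notin> (^) q ` {..<d - 1}"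
    using R_top_exponent_gt by fastforce
  then show ?thesis
    by (simp add: homogenization_eval_C_poly[OF \<iota>] C_exponents_def R_exponents_def
        sum.reindex[OF inj_power_q])
qed

end

lemma card_proj_points_C_poly:
  fixes \<iota> :: "'k::field \<Rightarrow> 'l::{field, finite}"
  assumes "prime p" and "r \<ge> 1" and q: "q = p ^ r" and card: "CARD('l) = q ^ n"
    and \<iota>: "field_embedding \<iota>" and dn: "(d, n) \<in> {(3, 6), (4, 8)}"
  shows "card (proj_curve_points \<iota> (C_poly q n d)) = 1 + q ^ (n - 1 + d)"
proof -
  have q2: "q \<ge> 2"
    using \<open>prime p\<close> \<open>r \<ge> 1\<close> q prime_ge_2_nat[of p] self_le_power[of p r] by simp
  have "CHAR('l) = p"
    using CHAR_eq_of_card_prime_power[OF \<open>prime p\<close>] card q by (simp add: power_mult[symmetric])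
  then have "(a + b) ^ q = a ^ q + b ^ q" for a b :: 'l
    using freshmans_dream'[where 'a = 'l and m = q and n = r] \<open>prime p\<close> q by simp
  with q2 card dn interpret finite_field_frobenius q n "TYPE('l)"
    by unfold_locales auto
  have bounds: "d \<ge> 2" "d + 2 \<le> n" "n = 2 * d"
    using dn by auto
  have "card (proj_curve_points \<iota> (C_poly q n d)) =
      1 + card {(x, y). homogenization_eval \<iota> (C_poly q n d) x y 1 = 0}"
    using q2 by (intro card_proj_curve_points_one_at_infinity)
      (simp_all add: field_embedding_0[OF \<iota>] homogenization_eval_C_poly_infinity[OF q2 bounds(1,2) \<iota>])
  also have "{(x, y). homogenization_eval \<iota> (C_poly q n d) x y 1 = 0} =
      {(x, y). (\<Sum>i<n. y ^ (q ^ i)) = R d x}"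
    by (simp add: homogenization_eval_C_poly_affine[OF q2 bounds(1,2) \<iota>] R_def)
  also have "card \<dots> = q ^ (n - 1 + d)"
    using bounds(3) dn R_fixed_iff_3 R_fixed_iff_4 by (intro card_affine_points) auto
  finally show ?thesis .
qed

theorem corollary14:
  fixes p r q n d :: nat
    and \<iota> :: "'k::{field, finite} \<Rightarrow> 'l::{field, finite}"
  assumes "prime p" and "r \<ge> 1" and "q = p ^ r"
    and "CARD('k) = q" and "CARD('l) = q ^ n"
    and "field_embedding \<iota>"
  shows "(d = 3 \<and> n = 6 \<longrightarrow>
            card (proj_curve_points \<iota> (C_poly q n d)) = 1 + q ^ (n - 1 + d) \<and>
            1 + q ^ (n - 1 + d) = 1 + q ^ 8) \<and>
         (d = 4 \<and> n = 8 \<longrightarrow>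
            card (proj_curve_points \<iota> (C_poly q n d)) = 1 + q ^ (n - 1 + d) \<and>
            1 + q ^ (n - 1 + d) = 1 + q ^ 11)"
  using card_proj_points_C_poly[OF assms(1,2,3,5,6)] by auto

end
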